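(* Let $l\in\mathbb C^\times$ and $V=V(l,\mathbf 1)=\coprod_{n\ge0}V_{(n)}$. The graded dimension $\sum_{n\ge0}\dim V_{(n)}\,q^n$ of $V(l,\mathbf 1)$ equals $$1+\sum_{n=2}^\infty 2(n-1)\cdot{}_2F_1\!\left(1-\frac n2,\frac{3-n}2;2;4\right)q^n,$$ where ${}_2F_1$ is the Gauss hypergeometric series (which terminates for these parameters).
   Context: $V(l,\mathbf 1)$ is the meromorphic open-string vertex algebra of a two-dimensional, connected, complete, orientable Riemannian manifold $M$ of constant sectional curvature $K\neq0$: it is the graded vector space with basis the formal noncommutative words $$h_{i_1}(-m_1)\cdots h_{i_k}(-m_k)\mathbf 1,\quad k\ge0,\ m_j\in\mathbb Z_+,\ i_j\in\{+,-\},\ \#\{j:i_j=+\}=\#\{j:i_j=-\},$$ where such a word has weight $m_1+\cdots+m_k$ (different words are linearly independent; the letters do not commute). $V_{(n)}$ is the span of words of weight $n$. Here ${}_2F_1(a,b;c;z)=\sum_{q\ge0}\frac{(a)_q(b)_q}{(c)_q}\frac{z^q}{q!}$ with $(a)_q=a(a+1)\cdots(a+q-1)$. *)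

theory Defs
  imports "HOL-Analysis.Analysis" "HOL-Library.Poly_Mapping"
begin

datatype sign = Plus | Minus

text \<open>
  The pair \<open>(i, m)\<close> with \<open>m > 0\<close> stands for the letter \<open>h\<^sub>i(-m)\<close>, and a list of such
  pairs for the word obtained by applying the letters, in this order, to the vacuum; the
  empty list is the vacuum itself.
\<close>

type_synonym mosva_word = "(sign \<times> nat) list"

definition admissible_word :: "mosva_word \<Rightarrow> bool" where
  "admissible_word w \<longleftrightarrow> (\<forall>(i, m) \<in> set w. m > 0) \<and>
     count_list (map fst w) Plus = count_list (map fst w) Minus"

definition word_weight :: "mosva_word \<Rightarrow> nat" where
  "word_weight w = sum_list (map snd w)"

definition pm_scale :: "complex \<Rightarrow> ('a \<Rightarrow>\<^sub>0 complex) \<Rightarrow> ('a \<Rightarrow>\<^sub>0 complex)" where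
  "pm_scale c f = Poly_Mapping.map ((*) c) f"

lemma lookup_pm_scale: "Poly_Mapping.lookup (pm_scale c f) x = c * Poly_Mapping.lookup f x"
  unfolding pm_scale_def by (simp add: Poly_Mapping.map.rep_eq when_def)

interpretation pm: vector_space "pm_scale :: complex \<Rightarrow> ('a \<Rightarrow>\<^sub>0 complex) \<Rightarrow> _"
  by unfold_locales
    (auto intro!: poly_mapping_eqI simp: lookup_pm_scale lookup_add algebra_simps)

text \<open>
  The underlying graded vector space of the meromorphic open-string vertex algebra
  \<open>V(l, 1)\<close>, inside the free complex vector space on all words: the space \<open>V(l, 1)\<close> and
  its component of weight \<open>n\<close>.  The level \<open>l\<close> (as well as the value of the nonzero
  curvature) only affects the vertex operators, which play no role for the grading; the
  graded vector space is the same for all \<open>l\<close>.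
\<close>

definition mosva :: "complex \<Rightarrow> (mosva_word \<Rightarrow>\<^sub>0 complex) set" where
  "mosva l = pm.span {Poly_Mapping.single w 1 | w. admissible_word w}"

definition mosva_component :: "complex \<Rightarrow> nat \<Rightarrow> (mosva_word \<Rightarrow>\<^sub>0 complex) set" where
  "mosva_component l n =
     pm.span {Poly_Mapping.single w 1 | w. admissible_word w \<and> word_weight w = n}"

lemma independent_words:
  "pm.independent (range (\<lambda>w. Poly_Mapping.single (w :: 'a) (1::complex)))"
proof -
  have "u v = 0"
    if t: "finite t" "t \<subseteq> range (\<lambda>w. Poly_Mapping.single (w :: 'a) (1::complex))"
      and s: "(\<Sum>v\<in>t. pm_scale (u v) v) = 0" and v: "v \<in> t" for t u v
  proof -
    obtain w where w: "v = Poly_Mapping.single w 1" using t v by auto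
    have "0 = Poly_Mapping.lookup (\<Sum>v\<in>t. pm_scale (u v) v) w" using s by simp
    also have "\<dots> = (\<Sum>x\<in>t. u x * Poly_Mapping.lookup x w)"
      by (simp add: lookup_sum lookup_pm_scale)
    also have "\<dots> = (\<Sum>x\<in>t. if x = v then u v else 0)"
    proof (rule sum.cong[OF refl])
      fix x assume "x \<in> t"
      then obtain w' where w': "x = Poly_Mapping.single w' 1" using t by blast
      have "Poly_Mapping.lookup x w = (if x = v then 1 else 0)"
        unfolding w w' by (cases "w' = w")
          (auto simp: lookup_single when_def dest: arg_cong[of _ _ Poly_Mapping.keys])
      then show "u x * Poly_Mapping.lookup x w = (if x = v then u v else 0)" by simp
    qed
    also have "\<dots> = u v" using t v by simp
    finally show ?thesis by simp
  qed
  then show ?thesis unfolding pm.independent_explicit_module by (intro allI impI)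
qed

lemma mosva_eq_span_components: "mosva l = pm.span (\<Union>n. mosva_component l n)"
proof (rule antisym)
  show "mosva l \<subseteq> pm.span (\<Union>n. mosva_component l n)"
    unfolding mosva_def mosva_component_def
    by (rule pm.span_mono) (blast intro: pm.span_base)
  show "pm.span (\<Union>n. mosva_component l n) \<subseteq> mosva l"
    unfolding mosva_def mosva_component_def
    by (intro pm.span_minimal pm.subspace_span UN_least pm.span_mono) blast
qed

text \<open>
  \<open>pm.dim\<close> is \<open>0\<close> on infinite-dimensional subspaces; the following shows that every
  component is finite-dimensional, so that \<open>pm.dim\<close> is its true dimension.
\<close>

lemma finite_admissible_words: "finite {w. admissible_word w \<and> word_weight w = n}"
proof (rule finite_subset)
  have UNIV_sign: "(UNIV :: sign set) = {Plus, Minus}"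
    using sign.exhaust by auto
  show "finite {w. set w \<subseteq> (UNIV :: sign set) \<times> {0..n} \<and> length w \<le> n}"
    by (rule finite_lists_length_le) (simp add: UNIV_sign)
  have len: "length w \<le> sum_list (map snd w)" if "\<forall>(i, m) \<in> set w. m > 0" for w :: mosva_word
    using that by (induction w) auto
  have "m \<le> sum_list (map snd w)" if "(i, m) \<in> set w" for i m and w :: mosva_word
    using that by (induction w) force+
  then show "{w. admissible_word w \<and> word_weight w = n}
      \<subseteq> {w. set w \<subseteq> UNIV \<times> {0..n} \<and> length w \<le> n}"
    using len by (auto simp: admissible_word_def word_weight_def)
qed

lemma mosva_component_finite_spanning_set:
  "\<exists>B. finite B \<and> mosva_component l n = pm.span B"
proof (intro exI conjI)
  show "finite {Poly_Mapping.single w (1::complex) | w. admissible_word w \<and> word_weight w = n}"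
    unfolding setcompr_eq_image by (rule finite_imageI[OF finite_admissible_words])
qed (rule mosva_component_def)

definition graded_dim :: "(nat \<Rightarrow> (mosva_word \<Rightarrow>\<^sub>0 complex) set) \<Rightarrow> real fps" where
  "graded_dim V = Abs_fps (\<lambda>n. real (pm.dim (V n)))"

definition gauss_2F1 :: "real \<Rightarrow> real \<Rightarrow> real \<Rightarrow> real \<Rightarrow> real" where
  "gauss_2F1 a b c z = suminf (\<lambda>q. pochhammer a q * pochhammer b q / pochhammer c q * (z ^ q / fact q))"

text \<open>
  Outside the unit disc \<open>gauss_2F1\<close> is used only for terminating series, as below; in this
  case the infinite sum is the sum of finitely many nonzero terms.
\<close>

lemma gauss_2F1_terminates:
  assumes "n \<ge> 2"
  shows "finite {q. pochhammer (1 - real n / 2) q * pochhammer ((3 - real n) / 2) q \<noteq> 0}"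
proof (rule finite_subset)
  show "finite {..n}" by simp
  show "{q. pochhammer (1 - real n / 2) q * pochhammer ((3 - real n) / 2) q \<noteq> 0} \<subseteq> {..n}"
  proof (rule subsetI, rule ccontr)
    fix q
    assume q: "q \<in> {q. pochhammer (1 - real n / 2) q * pochhammer ((3 - real n) / 2) q \<noteq> 0}"
      and "q \<notin> {..n}"
    then have "q > n" by simp
    show False
    proof (cases "even n")
      case True
      then obtain k where k: "n = 2 * k" by (elim evenE)
      then have "1 - real n / 2 = - of_nat (k - 1)" "k - 1 < q"
        using assms \<open>q > n\<close> by (auto simp: of_nat_diff)
      then have "pochhammer (1 - real n / 2) q = 0"
        by (metis pochhammer_of_nat_eq_0_lemma)
      with q show False by simp
    next
      case False
      then obtain k where k: "n = 2 * k + 1" by (elim oddE)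
      then have "(3 - real n) / 2 = - of_nat (k - 1)" "k - 1 < q"
        using assms \<open>q > n\<close> by (auto simp: of_nat_diff field_simps)
      then have "pochhammer ((3 - real n) / 2) q = 0"
        by (metis pochhammer_of_nat_eq_0_lemma)
      with q show False by simp
    qed
  qed
qed

end

theory Submission
  imports Defs
begin

text \<open>
  An admissible word of weight \<open>n > 0\<close> and length \<open>2 (q + 1)\<close> is a balanced sign pattern together
  with a composition of \<open>n\<close> into \<open>2 (q + 1)\<close> positive parts, so there are
  \<open>(2q + 2 choose q + 1) (n - 1 choose 2q + 1)\<close> of them. This is exactly \<open>2 (n - 1)\<close> times the
  \<open>q\<close>-th term of the hypergeometric series.
\<close>

section \<open>Counting words: sign patterns, compositions, and their combination\<close>

lemma length_eq_count_signs: "length s = count_list s Plus + count_list s Minus"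
proof (induction s)
  case (Cons a s)
  then show ?case by (cases a) auto
qed simp

text \<open>Splitting by the first sign reproduces Pascal's rule; \<open>k\<close> must vary in the
  induction because a leading \<open>Plus\<close> lowers it by one.\<close>

lemma card_sign_lists: "card {s. length s = m \<and> count_list s Plus = k} = m choose k"
proof (induction m arbitrary: k)
  case 0
  have "{s. length s = 0 \<and> count_list s Plus = k} = (if k = 0 then {[]} else {})"
    by auto
  then show ?case by (cases k) auto
next
  case (Suc m)
  let ?S = "\<lambda>m k. {s. length s = m \<and> count_list s Plus = k}"
  \<comment> \<open>Tails after a leading \<open>Plus\<close>. The \<open>Suc\<close> on the left
    makes this set empty for \<open>k = 0\<close>, where truncated \<open>k - 1\<close> would
    not.\<close>
  let ?P = "{s. length s = m \<and> Suc (count_list s Plus) = k}"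
  have fin: "finite (?S m j)" for j
  proof (rule finite_subset)
    have "(UNIV :: sign set) = {Plus, Minus}" using sign.exhaust by auto
    then have "finite (UNIV :: sign set)" by (metis finite.emptyI finite.insertI)
    then show "finite {s :: sign list. set s \<subseteq> UNIV \<and> length s = m}"
      by (rule finite_lists_length_eq)
  qed auto
  have P: "finite ?P" "card ?P = (case k of 0 \<Rightarrow> 0 | Suc j \<Rightarrow> m choose j)"
    using Suc fin by (cases k; simp)+
  have "?S (Suc m) k = (#) Plus ` ?P \<union> (#) Minus ` ?S m k"
  proof (intro set_eqI iffI)
    fix s assume "s \<in> ?S (Suc m) k"
    then show "s \<in> (#) Plus ` ?P \<union> (#) Minus ` ?S m k"
      by (cases s; cases "hd s") auto
  qed auto
  moreover have "(#) Plus ` ?P \<inter> (#) Minus ` ?S m k = {}" by auto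
  ultimately have "card (?S (Suc m) k) = card ?P + card (?S m k)"
    using P fin by (simp add: card_Un_disjoint card_image)
  then show ?case using P Suc by (cases k) auto
qed

text \<open>Lowering each of the \<open>Suc m\<close> positive parts by one leaves a weak
  composition of \<open>n - m\<close>, and stars and bars counts these.\<close>

lemma card_compositions:
  "card {c :: nat list. length c = Suc m \<and> (\<forall>x\<in>set c. x > 0) \<and> sum_list c = Suc n} = n choose m"
proof -
  let ?C = "{c :: nat list. length c = Suc m \<and> (\<forall>x\<in>set c. x > 0) \<and> sum_list c = Suc n}"
  \<comment> \<open>Stated without subtraction, so that the set is empty when \<open>n < m\<close>,
    in agreement with \<open>n choose m = 0\<close>.\<close>
  let ?D = "{d :: nat list. length d = Suc m \<and> sum_list d + m = n}"
  have sum_Suc: "sum_list (map Suc d) = sum_list d + length d" for d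
    by (induction d) auto
  have "?C = map Suc ` ?D"
  proof (intro set_eqI iffI)
    fix c assume c: "c \<in> ?C"
    then have eq: "c = map Suc (map (\<lambda>x. x - 1) c)"
      by (auto simp: map_idI)
    moreover have "map (\<lambda>x. x - 1) c \<in> ?D"
      using c sum_Suc[of "map (\<lambda>x. x - 1) c"] eq by simp
    ultimately show "c \<in> map Suc ` ?D" by (rule image_eqI)
  qed (auto simp: sum_Suc)
  moreover have "inj_on (map Suc) ?D" by (rule inj_on_subset[of _ UNIV]) auto
  ultimately have card: "card ?C = card ?D" by (simp only: card_image)
  show ?thesis
  proof (cases "m \<le> n")
    case True
    then have "?D = {d. length d = Suc m \<and> sum_list d = n - m}" by auto
    then have "card ?D = n choose (n - m)"
      using True card_length_sum_list[of "Suc m" "n - m"] by simp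
    then show ?thesis using card True binomial_symmetric[OF True] by (simp only:)
  next
    case False
    then have "?D = {}" by auto
    then show ?thesis using card False by (simp only: card.empty binomial_eq_0 not_le)
  qed
qed

text \<open>Unzipping a word separates its signs from its modes, and the two can be chosen
  independently.\<close>

lemma card_admissible_words_of_length:
  "card {w. admissible_word w \<and> word_weight w = Suc n \<and> length w = 2 * Suc q} =
     (2 * Suc q choose Suc q) * (n choose Suc (2 * q))"
proof -
  let ?W = "{w. admissible_word w \<and> word_weight w = Suc n \<and> length w = 2 * Suc q}"
  let ?S = "{s. length s = 2 * Suc q \<and> count_list s Plus = Suc q}"
  let ?C = "{c :: nat list. length c = Suc (Suc (2 * q)) \<and> (\<forall>x\<in>set c. x > 0) \<and> sum_list c = Suc n}"
  have "bij_betw (\<lambda>w. (map fst w, map snd w)) ?W (?S \<times> ?C)"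
  proof (rule bij_betwI[where g = "\<lambda>(s, c). zip s c"])
    show "(\<lambda>w. (map fst w, map snd w)) \<in> ?W \<rightarrow> ?S \<times> ?C"
    proof (rule funcsetI)
      fix w assume "w \<in> ?W"
      then show "(map fst w, map snd w) \<in> ?S \<times> ?C"
        \<comment> \<open>At total length \<open>2 * Suc q\<close>, balance of the signs amounts to
          exactly \<open>Suc q\<close> occurrences of \<open>Plus\<close>.\<close>
        using length_eq_count_signs[of "map fst w"]
        by (auto simp: admissible_word_def word_weight_def)
    qed
    show "(\<lambda>(s, c). zip s c) \<in> ?S \<times> ?C \<rightarrow> ?W"
    proof (rule funcsetI, clarify)
      fix s and c :: "nat list"
      assume "length s = 2 * Suc q" "count_list s Plus = Suc q" "length c = Suc (Suc (2 * q))"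
        "\<forall>x\<in>set c. x > 0" "sum_list c = Suc n"
      then show "admissible_word (zip s c) \<and> word_weight (zip s c) = Suc n \<and>
          length (zip s c) = 2 * Suc q"
        using length_eq_count_signs[of s]
        by (auto simp: admissible_word_def word_weight_def dest: set_zip_rightD)
    qed
  qed (auto simp: zip_map_fst_snd)
  then have "card ?W = card ?S * card ?C"
    by (simp add: bij_betw_same_card card_cartesian_product)
  then show ?thesis by (simp only: card_sign_lists card_compositions)
qed

lemma length_le_word_weight: "admissible_word w \<Longrightarrow> length w \<le> word_weight w"
proof -
  have "\<forall>(i, m) \<in> set w. m > 0 \<Longrightarrow> length w \<le> sum_list (map snd w)" for w :: mosva_word
    by (induction w) auto
  then show "admissible_word w \<Longrightarrow> length w \<le> word_weight w"
    by (simp add: admissible_word_def word_weight_def)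
qed

text \<open>A balanced word has even length, which is nonzero for positive weight and at most the
  weight. The range of \<open>q\<close> is therefore generous; its surplus terms vanish.\<close>

lemma card_admissible_words:
  "card {w. admissible_word w \<and> word_weight w = Suc n} =
     (\<Sum>q\<le>Suc n. (2 * Suc q choose Suc q) * (n choose Suc (2 * q)))"
proof -
  let ?W = "\<lambda>q. {w. admissible_word w \<and> word_weight w = Suc n \<and> length w = 2 * Suc q}"
  have "{w. admissible_word w \<and> word_weight w = Suc n} = (\<Union>q\<in>{..Suc n}. ?W q)"
  proof (intro set_eqI iffI)
    fix w assume "w \<in> {w. admissible_word w \<and> word_weight w = Suc n}"
    then have w: "admissible_word w" "word_weight w = Suc n" by auto
    then have "w \<noteq> []" by (auto simp: word_weight_def)
    moreover have len: "length w = 2 * count_list (map fst w) Plus"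
      using w length_eq_count_signs[of "map fst w"] by (simp add: admissible_word_def)
    ultimately obtain q where "length w = 2 * Suc q"
      by (cases "count_list (map fst w) Plus") auto
    with w show "w \<in> (\<Union>q\<in>{..Suc n}. ?W q)"
      using length_le_word_weight[of w] by auto
  qed auto
  moreover have "finite (?W q)" for q
    by (rule finite_subset[OF _ finite_admissible_words[of "Suc n"]]) auto
  ultimately have "card {w. admissible_word w \<and> word_weight w = Suc n} = (\<Sum>q\<le>Suc n. card (?W q))"
    by (simp only:) (rule card_UN_disjoint, auto)
  then show ?thesis by (simp only: card_admissible_words_of_length)
qed

section \<open>From dimensions to word counts\<close>

lemma dim_mosva_component:
  "pm.dim (mosva_component l n) = card {w. admissible_word w \<and> word_weight w = n}"
proof -
  let ?single = "\<lambda>w :: mosva_word. Poly_Mapping.single w (1 :: complex)"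
  let ?W = "{w. admissible_word w \<and> word_weight w = n}"
  have "inj ?single"
    by (rule injI) (metis keys_single one_neq_zero singleton_inject)
  then have "card (?single ` ?W) = card ?W"
    by (intro card_image) (rule inj_on_subset, auto)
  moreover have "pm.independent (?single ` ?W)"
    by (rule pm.independent_mono[OF independent_words]) auto
  moreover have "mosva_component l n = pm.span (?single ` ?W)"
    by (simp only: mosva_component_def setcompr_eq_image)
  \<comment> \<open>The words of weight \<open>n\<close> form a basis of the component, and distinct
    words give distinct basis vectors.\<close>
  ultimately show ?thesis
    using pm.dim_span_eq_card_independent[of "?single ` ?W"] by presburger
qed

section \<open>Matching the counts with the hypergeometric series\<close>

text \<open>
  With \<open>m = n - 2\<close>, the factor \<open>4 ^ q\<close> cancels against Legendre duplication:
  \<open>(1 - n/2)\<^sub>q ((3 - n)/2)\<^sub>q = (2 - n)\<^bsub>2q\<^esub> / 4 ^ q\<close>.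
\<close>

lemma pochhammer_halves:
  "pochhammer (- real m / 2) q * pochhammer ((1 - real m) / 2) q * 4 ^ q =
     fact (2 * q) * real (m choose (2 * q))"
proof -
  have "pochhammer (- real m) (2 * q) =
      4 ^ q * pochhammer (- real m / 2) q * pochhammer ((1 - real m) / 2) q"
    using pochhammer_double[of "- real m / 2" q]
    by (simp add: power_mult diff_divide_distrib add.commute)
  \<comment> \<open>The usual sign \<open>(-1) ^ (2 * q)\<close> is 1.\<close>
  moreover have "real (m choose (2 * q)) = pochhammer (- real m) (2 * q) / fact (2 * q)"
    by (simp add: binomial_gbinomial gbinomial_pochhammer)
  ultimately show ?thesis by (simp add: field_simps)
qed

text \<open>Splitting the first factor 1 off \<open>pochhammer 1 (Suc q)\<close>, which is a
  factorial, leaves \<open>pochhammer 2 q\<close>.\<close>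

lemma pochhammer_2: "pochhammer 2 q = (fact (Suc q) :: real)"
  using pochhammer_rec[of "1 :: real" q] by (simp add: pochhammer_fact)

lemma hypergeometric_term:
  "2 * real (Suc m) * (pochhammer (- real m / 2) q * pochhammer ((1 - real m) / 2) q /
     pochhammer 2 q * (4 ^ q / fact q)) =
   real ((2 * Suc q choose Suc q) * (Suc m choose Suc (2 * q)))"
proof -
  have a: "real (2 * Suc q choose Suc q) = fact (2 * Suc q) / (fact (Suc q) * fact (Suc q))"
    using binomial_fact[of "Suc q" "2 * Suc q", where 'a = real] by simp
  \<comment> \<open>Absorption identity: it takes the prefactor \<open>Suc m\<close> into the
    binomial coefficient.\<close>
  have "real (Suc m) * real (m choose (2 * q)) = real (Suc (2 * q)) * real (Suc m choose Suc (2 * q))"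
    using Suc_times_binomial_eq[of m "2 * q"] by (metis mult.commute of_nat_mult)
  then have b: "real (Suc m choose Suc (2 * q)) =
      real (Suc m) * real (m choose (2 * q)) / real (Suc (2 * q))"
    by (simp add: field_simps)
  \<comment> \<open>The prefactor 2 of the dimension formula comes from the factor
    \<open>2 * Suc q\<close> here.\<close>
  have c: "(fact (2 * Suc q) :: real) = 2 * real (Suc q) * real (Suc (2 * q)) * fact (2 * q)"
    by (simp add: algebra_simps)
  have d: "(fact (Suc q) :: real) = real (Suc q) * fact q" by simp
  have "2 * real (Suc m) * (pochhammer (- real m / 2) q * pochhammer ((1 - real m) / 2) q /
      pochhammer 2 q * (4 ^ q / fact q)) =
    2 * real (Suc m) * (pochhammer (- real m / 2) q * pochhammer ((1 - real m) / 2) q * 4 ^ q) /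
      (fact (Suc q) * fact q)"
    by (simp add: pochhammer_2)
  also have "\<dots> = 2 * real (Suc m) * (fact (2 * q) * real (m choose (2 * q))) / (fact (Suc q) * fact q)"
    by (simp only: pochhammer_halves)
  also have "\<dots> = real (2 * Suc q choose Suc q) * real (Suc m choose Suc (2 * q))"
    unfolding a b c d by (simp add: divide_simps del: of_nat_Suc)
  finally show ?thesis by simp
qed

lemma card_admissible_words_hypergeometric:
  "real (card {w. admissible_word w \<and> word_weight w = Suc (Suc m)}) =
     2 * real (Suc m) * gauss_2F1 (- real m / 2) ((1 - real m) / 2) 2 4"
proof -
  define t where "t q = pochhammer (- real m / 2) q * pochhammer ((1 - real m) / 2) q /
     pochhammer 2 q * (4 ^ q / fact q)" for q
  have t: "2 * real (Suc m) * t q = real ((2 * Suc q choose Suc q) * (Suc m choose Suc (2 * q)))" for q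
    unfolding t_def by (rule hypergeometric_term)
  \<comment> \<open>Termination is read off the counting side: there
    \<open>Suc m choose Suc (2 * q)\<close> vanishes, and the prefactor is nonzero. The infinite
    series thus becomes the finite sum of word counts.\<close>
  have "t q = 0" if "q \<notin> {..Suc (Suc m)}" for q
  proof -
    have "2 * real (Suc m) * t q = 0" using that by (simp only: t) (simp add: binomial_eq_0)
    then show ?thesis by simp
  qed
  then have "gauss_2F1 (- real m / 2) ((1 - real m) / 2) 2 4 = (\<Sum>q\<le>Suc (Suc m). t q)"
    unfolding gauss_2F1_def t_def[symmetric] by (intro suminf_finite) auto
  then show ?thesis
    by (simp only: card_admissible_words sum_distrib_left t of_nat_sum)
qed

theorem corollary3p14:
  fixes l :: complex
  assumes "l \<noteq> 0"
  shows "graded_dim (mosva_component l) =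
    1 + Abs_fps (\<lambda>n. if n \<ge> 2
          then 2 * (real n - 1) * gauss_2F1 (1 - real n / 2) ((3 - real n) / 2) 2 4
          else 0)"
proof (rule fps_ext)
  fix n
  consider "n = 0" | "n = 1" | m where "n = Suc (Suc m)"
    by (cases n; cases "n - 1") auto
  then show "fps_nth (graded_dim (mosva_component l)) n =
    fps_nth (1 + Abs_fps (\<lambda>n. if n \<ge> 2
          then 2 * (real n - 1) * gauss_2F1 (1 - real n / 2) ((3 - real n) / 2) 2 4
          else 0)) n"
  proof cases
    case 1
    \<comment> \<open>The vacuum alone has weight 0 and accounts for the constant term 1.\<close>
    have "{w. admissible_word w \<and> word_weight w = 0} = {[]}"
    proof (intro set_eqI iffI)
      fix w assume "w \<in> {w. admissible_word w \<and> word_weight w = 0}"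
      then show "w \<in> {[]}" using length_le_word_weight[of w] by auto
    qed (simp add: admissible_word_def word_weight_def)
    with 1 show ?thesis by (simp add: graded_dim_def dim_mosva_component)
  next
    case 2
    \<comment> \<open>Weight 1 leaves no room for two letters: every binomial
      \<open>0 choose Suc (2 * q)\<close> is 0.\<close>
    then show ?thesis
      using card_admissible_words[of 0] by (simp add: graded_dim_def dim_mosva_component)
  next
    case 3
    \<comment> \<open>The shift \<open>m = n - 2\<close> brings the stated parameters into the form
      used above.\<close>
    then have "1 - real n / 2 = - real m / 2" "(3 - real n) / 2 = (1 - real m) / 2"
      "real n - 1 = real (Suc m)"
      by (auto simp: field_simps)
    moreover have "n \<ge> 2" using 3 by simp
    ultimately show ?thesis
      using card_admissible_words_hypergeometric[of m] 3
      by (simp only: graded_dim_def dim_mosva_component fps_add_nth fps_one_nth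
          fps_nth_Abs_fps if_True) simp
  qed
qed

end
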